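(* Let $X$ be an $\mathbb{F}_1$-module (that is, a $\Gamma$-set), let $I=\{1,\ldots,n\}$, and let $\{I_j\}_{j=1}^m$ be a partition of $I$. For any collection of subsets $\{A_i\}_{i\in I}$ of $X(1_+)$, one has $$\bigoplus_{i\in I}A_i\subseteq\bigoplus_{j=1}^m\left(\bigoplus_{i\in I_j}A_i\right).$$
   Context: **$\Gamma$-sets.** $\Gamma^{\mathrm{op}}$ is the category whose objects are the pointed finite sets $n_+=\{0,1,\ldots,n\}$, $n\ge 0$, with basepoint $0$, and whose morphisms are basepoint-preserving maps. A $\Gamma$-set, also called an $\mathbb{F}_1$-module, is a pointed functor $X:\Gamma^{\mathrm{op}}\to\mathbf{Set}_*$ to pointed sets (pointed: $X(0_+)=\{*\}$). **$n$-ary sums.** For $1\le i\le n$ let $p_{i,n}:n_+\to 1_+$ be the map with $p_{i,n}(i)=1$ and $p_{i,n}(j)=0$ for $j\ne i$. Let $s_n:n_+\to 1_+$ be the map with $s_n(0)=0$ and $s_n(j)=1$ for $j\neq 0$. For $a_1,\ldots,a_n\in X(1_+)$ the $n$-ary sum is the subset of $X(1_+)$ $$\bigoplus_{i=1}^n a_i:=\{X(s_n)(z)\mid z\in X(n_+),\ X(p_{i,n})(z)=a_i\text{ for all }i=1,\ldots,n\}.$$ In particular the $1$-ary sum of $a$ is $\{a\}$ and the $0$-ary sum is $\{*\}$. For subsets $A_1,\ldots,A_n\subseteq X(1_+)$, $\bigoplus_{i=1}^nA_i:=\bigcup_{a_1\in A_1,\ldots,a_n\in A_n}\bigoplus_{i=1}^na_i$.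 For a subset $J\subseteq\{1,\ldots,n\}$ with $k$ elements, $\bigoplus_{i\in J}A_i$ denotes the $k$-ary sum of the family $(A_i)_{i\in J}$ listed in increasing order of index. *)

theory Defs
  imports Main "HOL-Library.FuncSet" "HOL-Library.Disjoint_Sets"
begin

text \<open>
  The pointed set \<open>n\<^sub>+\<close> is \<open>{0..n}\<close> with basepoint \<open>0\<close>. Maps are extensional functions
  (\<open>undefined\<close> outside the domain), so that equal maps are equal as HOL functions;
  composition is \<^const>\<open>compose\<close> and the identity is a \<^const>\<open>restrict\<close>.
\<close>

definition pointed_maps :: "nat \<Rightarrow> nat \<Rightarrow> (nat \<Rightarrow> nat) set" where
  "pointed_maps m n = {f \<in> {0..m} \<rightarrow>\<^sub>E {0..n}. f 0 = 0}"

text \<open>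
  The sets \<open>obj X n = X(n\<^sub>+)\<close> are subsets of one type. This loses no generality, since any
  sequence of sets embeds in its disjoint union. An extensional function does not determine
  its codomain, so \<open>act X m n f\<close>, which is \<open>X(f)\<close> for \<open>f : m\<^sub>+ \<rightarrow> n\<^sub>+\<close>, takes both objects as
  arguments; only its values on \<open>obj X m\<close> are relevant.
\<close>

record 'a gamma_data =
  obj :: "nat \<Rightarrow> 'a set"
  pt :: "nat \<Rightarrow> 'a"
  act :: "nat \<Rightarrow> nat \<Rightarrow> (nat \<Rightarrow> nat) \<Rightarrow> 'a \<Rightarrow> 'a"

locale gamma_set =
  fixes X :: "'a gamma_data"
  assumes pt_in_obj: "pt X n \<in> obj X n"
    and act_closed: "f \<in> pointed_maps m n \<Longrightarrow> z \<in> obj X m \<Longrightarrow> act X m n f z \<in> obj X n"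
    and act_pt: "f \<in> pointed_maps m n \<Longrightarrow> act X m n f (pt X m) = pt X n"
    and act_id: "z \<in> obj X n \<Longrightarrow> act X n n (\<lambda>i\<in>{0..n}. i) z = z"
    and act_compose: "f \<in> pointed_maps k m \<Longrightarrow> g \<in> pointed_maps m n \<Longrightarrow> z \<in> obj X k \<Longrightarrow>
      act X k n (compose {0..k} g f) z = act X m n g (act X k m f z)"
    and obj_0: "obj X 0 = {pt X 0}"

definition proj_map :: "nat \<Rightarrow> nat \<Rightarrow> nat \<Rightarrow> nat" where
  "proj_map i n = (\<lambda>j\<in>{0..n}. if j = i then 1 else 0)"

definition sum_map :: "nat \<Rightarrow> nat \<Rightarrow> nat" where
  "sum_map n = (\<lambda>j\<in>{0..n}. if j = 0 then 0 else 1)"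

text \<open>Families \<open>a\<^sub>1, \<dots>, a\<^sub>n\<close> are functions on \<^typ>\<open>nat\<close> of which only the values on \<open>{1..n}\<close> are used.\<close>

definition nary_sum :: "'a gamma_data \<Rightarrow> nat \<Rightarrow> (nat \<Rightarrow> 'a) \<Rightarrow> 'a set" where
  "nary_sum X n a =
    {act X n 1 (sum_map n) z | z. z \<in> obj X n \<and> (\<forall>i\<in>{1..n}. act X n 1 (proj_map i n) z = a i)}"

definition nary_set_sum :: "'a gamma_data \<Rightarrow> nat \<Rightarrow> (nat \<Rightarrow> 'a set) \<Rightarrow> 'a set" where
  "nary_set_sum X n A = (\<Union>a\<in>(\<Pi>\<^sub>E i\<in>{1..n}. A i). nary_sum X n a)"

text \<open>
  Meant for finite \<open>J\<close>. List positions start at \<open>0\<close> while summands are numbered from \<open>1\<close>,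
  hence the shift.
\<close>

definition indexed_set_sum :: "'a gamma_data \<Rightarrow> nat set \<Rightarrow> (nat \<Rightarrow> 'a set) \<Rightarrow> 'a set" where
  "indexed_set_sum X J A = nary_set_sum X (card J) (\<lambda>l. A (sorted_list_of_set J ! (l - 1)))"

end

theory Submission
  imports Defs
begin

text \<open>
  An element of the left-hand side is \<open>X(s\<^sub>n)(z)\<close>. Let \<open>q : n\<^sub>+ \<rightarrow> m\<^sub>+\<close> send \<open>I\<^sub>j\<close> to \<open>j\<close>. Then
  \<open>s\<^sub>m \<circ> q = s\<^sub>n\<close>, so \<open>X(q)(z)\<close> witnesses membership in the \<open>m\<close>-ary sum, provided that its
  \<open>j\<close>-th coordinate lies in the sum over \<open>I\<^sub>j\<close>. Now \<open>p\<^sub>j \<circ> q\<close> is the indicator of \<open>I\<^sub>j\<close>, which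
  factors as \<open>s\<^sub>k \<circ> r\<close> with \<open>r : n\<^sub>+ \<rightarrow> k\<^sub>+\<close> enumerating \<open>I\<^sub>j\<close> and collapsing its complement,
  and the coordinates of \<open>X(r)(z)\<close> are those coordinates of \<open>z\<close> with index in \<open>I\<^sub>j\<close>.
\<close>

text \<open>Projections, sum maps and the composites in the idea above all have this form, so each
  commuting triangle reduces to comparing preimages.\<close>

definition indicator_map :: "nat set \<Rightarrow> nat \<Rightarrow> nat \<Rightarrow> nat" where
  "indicator_map J n = (\<lambda>j\<in>{0..n}. if j \<in> J then 1 else 0)"

lemma proj_map_eq_indicator_map: "proj_map i n = indicator_map {i} n"
  by (simp add: proj_map_def indicator_map_def)

lemma sum_map_eq_indicator_map: "sum_map n = indicator_map {1..n} n"
  by (auto simp: sum_map_def indicator_map_def fun_eq_iff)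

lemma indicator_map_pointed: "0 \<notin> J \<Longrightarrow> indicator_map J n \<in> pointed_maps n 1"
  by (auto simp: indicator_map_def pointed_maps_def)

lemma compose_indicator_map:
  assumes "f \<in> pointed_maps n m"
    and "\<And>i. i \<in> {0..n} \<Longrightarrow> i \<in> J \<longleftrightarrow> f i \<in> K"
  shows "compose {0..n} (indicator_map K m) f = indicator_map J n"
proof
  fix i
  show "compose {0..n} (indicator_map K m) f i = indicator_map J n i"
  proof (cases "i \<in> {0..n}")
    case True
    \<comment> \<open>The restricted function \<open>indicator_map K m\<close> can be evaluated only
      at points of its domain.\<close>
    moreover from True have "f i \<in> {0..m}"
      using assms(1) by (auto simp: pointed_maps_def)
    ultimately show ?thesis
      using assms(2) by (simp add: compose_def indicator_map_def)
  qed (simp add: compose_def indicator_map_def)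
qed

lemma (in gamma_set) act_indicator_map:
  assumes "f \<in> pointed_maps n m" and "z \<in> obj X n" and "0 \<notin> K"
    and "\<And>i. i \<in> {0..n} \<Longrightarrow> i \<in> J \<longleftrightarrow> f i \<in> K"
  shows "act X m 1 (indicator_map K m) (act X n m f z) = act X n 1 (indicator_map J n) z"
  using act_compose[OF assms(1) indicator_map_pointed[OF assms(3)] assms(2)]
    compose_indicator_map[OF assms(1,4)] by simp

text \<open>The family \<open>a\<close> is recovered from \<open>z\<close> as its coordinates, so
  the union over families disappears and a single witness \<open>z\<close> remains.\<close>

lemma mem_nary_set_sum_iff:
  "x \<in> nary_set_sum X n A \<longleftrightarrow>
    (\<exists>z\<in>obj X n. x = act X n 1 (sum_map n) z \<and> (\<forall>i\<in>{1..n}. act X n 1 (proj_map i n) z \<in> A i))"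
  (is "_ \<longleftrightarrow> ?R")
proof
  assume "x \<in> nary_set_sum X n A"
  then show ?R
    by (fastforce simp: nary_set_sum_def nary_sum_def PiE_iff)
next
  assume ?R
  then obtain z where z: "z \<in> obj X n" "x = act X n 1 (sum_map n) z"
      "\<forall>i\<in>{1..n}. act X n 1 (proj_map i n) z \<in> A i"
    by blast
  define a where "a = (\<lambda>i\<in>{1..n}. act X n 1 (proj_map i n) z)"
  have "a \<in> (\<Pi>\<^sub>E i\<in>{1..n}. A i)" "x \<in> nary_sum X n a"
    using z by (auto simp: a_def nary_sum_def)
  then show "x \<in> nary_set_sum X n A"
    unfolding nary_set_sum_def by blast
qed

text \<open>The factorisation through \<open>r\<close>. It works for any enumeration
  \<open>e\<close> of \<open>J\<close>; the increasing one is chosen only in the theorem.\<close>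

lemma (in gamma_set) act_indicator_map_mem_nary_set_sum:
  assumes e: "bij_betw e {1..k} J" and J: "J \<subseteq> {1..n}" and z: "z \<in> obj X n"
    and coord: "\<And>l. l \<in> {1..k} \<Longrightarrow> act X n 1 (proj_map (e l) n) z \<in> B l"
  shows "act X n 1 (indicator_map J n) z \<in> nary_set_sum X k B"
proof -
  define r where "r = (\<lambda>i\<in>{0..n}. if i \<in> J then inv_into {1..k} e i else 0)"
  have inv: "inv_into {1..k} e i \<in> {1..k}" "e (inv_into {1..k} e i) = i" if "i \<in> J" for i
    using that e by (auto simp: bij_betw_def inv_into_into f_inv_into_f simp del: atLeastAtMost_iff)
  have r: "r \<in> pointed_maps n k"
    using J inv(1) by (force simp: r_def pointed_maps_def)
  have "act X k 1 (sum_map k) (act X n k r z) = act X n 1 (indicator_map J n) z"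
    unfolding sum_map_eq_indicator_map
    using inv(1) by (intro act_indicator_map[OF r z]) (auto simp: r_def)
  moreover have "act X k 1 (proj_map l k) (act X n k r z) \<in> B l" if l: "l \<in> {1..k}" for l
  proof -
    \<comment> \<open>The fibre of \<open>r\<close> over \<open>l\<close> is the single index
      \<open>e l\<close>: since \<open>l\<close> is at least 1, no collapsed index lands
      there.\<close>
    have "i = e l \<longleftrightarrow> r i = l" if "i \<in> {0..n}" for i
    proof (cases "i \<in> J")
      case True
      then show ?thesis
        using inv[OF True] that l e by (auto simp: r_def bij_betw_def inv_into_f_f)
    next
      case False
      then show ?thesis
        using that l bij_betw_apply[OF e l] by (auto simp: r_def)
    qed
    then have "act X k 1 (proj_map l k) (act X n k r z) = act X n 1 (proj_map (e l) n) z"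
      unfolding proj_map_eq_indicator_map
      using l by (intro act_indicator_map[OF r z]) auto
    then show ?thesis
      using coord[OF l] by simp
  qed
  ultimately show ?thesis
    unfolding mem_nary_set_sum_iff using act_closed[OF r z] by metis
qed

lemma bij_betw_sorted_list_of_set_nth:
  assumes "finite (J :: nat set)"
  shows "bij_betw (\<lambda>l. sorted_list_of_set J ! (l - 1)) {1..card J} J"
proof -
  have "bij_betw (\<lambda>l. l - 1) {1..card J} {..<card J}"
    by (rule bij_betw_byWitness[where f' = Suc]) auto
  moreover have "bij_betw ((!) (sorted_list_of_set J)) {..<card J} J"
    using assms by (intro bij_betw_nth) auto
  ultimately show ?thesis
    using bij_betw_trans by (fastforce simp: comp_def)
qed

text \<open>The increasing enumeration of \<open>{1..n}\<close> is the identity once the shift by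
  one is taken into account.\<close>

lemma indexed_set_sum_atLeastAtMost: "indexed_set_sum X {1..n} A = nary_set_sum X n A"
proof -
  have "sorted_list_of_set {1..n} ! (l - 1) = l" if "l \<in> {1..n}" for l
  proof -
    have "sorted_list_of_set {1..n} = [1..<Suc n]"
      by (metis atLeastLessThanSuc_atLeastAtMost sorted_list_of_set_range)
    then show ?thesis
      using that by (simp del: upt_Suc)
  qed
  then show ?thesis
    by (auto simp: indexed_set_sum_def mem_nary_set_sum_iff)
qed

theorem theorem1:
  fixes X :: "'a gamma_data" and n m :: nat
    and I :: "nat \<Rightarrow> nat set" and A :: "nat \<Rightarrow> 'a set"
  assumes "gamma_set X"
    and "disjoint_family_on I {1..m}"
    and "(\<Union>j\<in>{1..m}. I j) = {1..n}"
    and "\<And>i. i \<in> {1..n} \<Longrightarrow> A i \<subseteq> obj X 1"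
  shows "indexed_set_sum X {1..n} A
    \<subseteq> nary_set_sum X m (\<lambda>j. indexed_set_sum X (I j) A)"
proof
  interpret gamma_set X by fact
  fix x
  assume "x \<in> indexed_set_sum X {1..n} A"
  then obtain z where z: "z \<in> obj X n" and x: "x = act X n 1 (sum_map n) z"
    and coord: "\<And>i. i \<in> {1..n} \<Longrightarrow> act X n 1 (proj_map i n) z \<in> A i"
    unfolding indexed_set_sum_atLeastAtMost mem_nary_set_sum_iff by blast
  have sub: "I j \<subseteq> {1..n}" if "j \<in> {1..m}" for j
    using assms(3) that by blast
  have "\<exists>j\<in>{1..m}. i \<in> I j" if "i \<in> {1..n}" for i
    using assms(3) that by blast
  then obtain b where b: "\<And>i. i \<in> {1..n} \<Longrightarrow> b i \<in> {1..m} \<and> i \<in> I (b i)"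
    by metis
  \<comment> \<open>Disjointness enters here: it makes the fibre of \<open>q\<close> over
    \<open>j\<close> all of \<open>I j\<close>, not just a subset.\<close>
  have b_unique: "b i = j" if "j \<in> {1..m}" "i \<in> I j" for i j
    using b[of i] sub[OF that(1)] that disjoint_family_onD[OF assms(2), of "b i" j] by blast
  define q where "q = (\<lambda>i\<in>{0..n}. if i = 0 then 0 else b i)"
  have q: "q \<in> pointed_maps n m"
    using b by (force simp: q_def pointed_maps_def)
  \<comment> \<open>Only 0 is sent to 0 by \<open>q\<close>, because \<open>b\<close> takes values
    in \<open>{1..m}\<close>.\<close>
  have "act X m 1 (sum_map m) (act X n m q z) = x"
    unfolding x sum_map_eq_indicator_map
    using b by (intro act_indicator_map[OF q z]) (auto simp: q_def)
  moreover have "act X m 1 (proj_map j m) (act X n m q z) \<in> indexed_set_sum X (I j) A"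
    if j: "j \<in> {1..m}" for j
  proof -
    have "i \<in> I j \<longleftrightarrow> q i \<in> {j}" if "i \<in> {0..n}" for i
    proof (cases "i = 0")
      case True
      then show ?thesis
        using j sub[OF j] by (auto simp: q_def)
    next
      case False
      then have "i \<in> {1..n}"
        using that by simp
      then show ?thesis
        using b[of i] b_unique[OF j] by (auto simp: q_def)
    qed
    then have "act X m 1 (proj_map j m) (act X n m q z) = act X n 1 (indicator_map (I j) n) z"
      unfolding proj_map_eq_indicator_map
      using j by (intro act_indicator_map[OF q z]) auto
    also have "\<dots> \<in> indexed_set_sum X (I j) A"
    proof -
      have e: "bij_betw (\<lambda>l. sorted_list_of_set (I j) ! (l - 1)) {1..card (I j)} (I j)"
        using sub[OF j] by (intro bij_betw_sorted_list_of_set_nth) (rule finite_subset, auto)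
      show ?thesis
        unfolding indexed_set_sum_def
        using coord sub[OF j] bij_betw_apply[OF e]
        by (intro act_indicator_map_mem_nary_set_sum[OF e sub[OF j] z]) blast
    qed
    finally show ?thesis .
  qed
  ultimately show "x \<in> nary_set_sum X m (\<lambda>j. indexed_set_sum X (I j) A)"
    unfolding mem_nary_set_sum_iff using act_closed[OF q z] by metis
qed

end
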